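(* Let $p,n$ be positive integers with $p\ge n\ge 7$ and $p=k(n-1)+n-5$ with $k$ a positive integer. Then $$ex(p;T_n^* )=\frac{(n-2)(p-2)}{2}+1.$$
   Context: All graphs are finite simple graphs. For $n\ge 4$, $T_n^*$ denotes the tree on the $n$ vertices $v_0,v_1,\ldots,v_{n-1}$ with edge set $\{v_0v_1,\ldots,v_0v_{n-3},\,v_{n-3}v_{n-2},\,v_{n-2}v_{n-1}\}$. For a graph $L$, $ex(p;L)$ denotes the maximal number of edges in a graph on $p$ vertices that does not contain $L$ as a (not necessarily induced) subgraph. *)

theory Defs
  imports Complex_Main
begin

text \<open>A finite simple graph is a vertex set together with a set of two-element subsets of it.\<close>

type_synonym 'a graph = "'a set \<times> 'a set set"

abbreviation verts :: "'a graph \<Rightarrow> 'a set" where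
  "verts \<equiv> fst"

abbreviation edges :: "'a graph \<Rightarrow> 'a set set" where
  "edges \<equiv> snd"

definition simple_graph :: "'a graph \<Rightarrow> bool" where
  "simple_graph G \<longleftrightarrow>
     finite (verts G) \<and> (\<forall>e\<in>edges G. e \<subseteq> verts G \<and> card e = 2)"

text \<open>Containment of a copy of \<open>L\<close> as a not necessarily induced subgraph.\<close>

definition contains_graph :: "'b graph \<Rightarrow> 'a graph \<Rightarrow> bool" where
  "contains_graph G L \<longleftrightarrow>
     (\<exists>f. inj_on f (verts L) \<and> f ` verts L \<subseteq> verts G \<and>
          (\<forall>e\<in>edges L. f ` e \<in> edges G))"

text \<open>The host graphs have vertices in \<^typ>\<open>nat\<close>, which loses no generality: every finite
  graph is isomorphic to such a graph. The maximum is over a finite set, and the set is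
  nonempty as soon as \<open>L\<close> has an edge (see \<open>turan_ex_set\<close>); otherwise the value may be
  unspecified.\<close>

definition turan_ex :: "nat \<Rightarrow> 'a graph \<Rightarrow> nat" where
  "turan_ex p L =
     Max {card (edges G) | G :: nat graph.
            simple_graph G \<and> card (verts G) = p \<and> \<not> contains_graph G L}"

text \<open>The vertex \<open>v\<^sub>i\<close> is represented by \<open>i\<close>; the intended range is \<open>n \<ge> 4\<close>.\<close>

definition T_star :: "nat \<Rightarrow> nat graph" where
  "T_star n =
     ({0..<n},
      {{0, i} | i. 1 \<le> i \<and> i \<le> n - 3} \<union> {{n - 3, n - 2}, {n - 2, n - 1}})"

lemma simple_graph_T_star:
  assumes "n \<ge> 4"
  shows "simple_graph (T_star n)"
  using assms by (auto simp: simple_graph_def T_star_def card_insert_if)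

lemma turan_ex_set:
  fixes p :: nat and L :: "'a graph"
  defines "S \<equiv> {card (edges G) | G :: nat graph.
            simple_graph G \<and> card (verts G) = p \<and> \<not> contains_graph G L}"
  shows "finite S" and "edges L \<noteq> {} \<Longrightarrow> S \<noteq> {}"
proof -
  have "card (edges G) \<le> 2 ^ p" if "simple_graph G" "card (verts G) = p" for G :: "nat graph"
  proof -
    have "edges G \<subseteq> Pow (verts G)" "finite (verts G)"
      using that by (auto simp: simple_graph_def)
    then show ?thesis
      using card_mono[of "Pow (verts G)" "edges G"] that by (simp add: card_Pow)
  qed
  then have "S \<subseteq> {..2 ^ p}" by (auto simp: S_def)
  then show "finite S" by (rule finite_subset) simp
  assume "edges L \<noteq> {}"
  then have "\<not> contains_graph ({0..<p}, {} :: nat set set) L"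
    by (auto simp: contains_graph_def)
  moreover have "simple_graph ({0..<p}, {} :: nat set set)"
    by (simp add: simple_graph_def)
  ultimately have "card (edges ({0..<p}, {} :: nat set set)) \<in> S"
    unfolding S_def by fastforce
  then show "S \<noteq> {}" by blast
qed

end

theory Submission
  imports Defs
begin

text \<open>
  The graph consisting of \<open>k - 1\<close> copies of \<open>K\<^sub>n\<^sub>-\<^sub>1\<close> and one \<open>K\<^sub>n\<^sub>-\<^sub>3\<^sub>,\<^sub>n\<^sub>-\<^sub>3\<close> attains the bound. For the
  upper bound, consider the deficiency, the sum of \<open>n - 2 - deg x\<close>, of each connected component.
  A component with \<open>m \<le> n - 1\<close> vertices has deficiency at least \<open>m (n - 1 - m)\<close>. A component with
  \<open>m \<ge> n\<close> vertices has deficiency at least \<open>m\<close> if all its degrees are at most \<open>n - 3\<close>; otherwise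
  the vertices not adjacent to a vertex of degree at least \<open>n - 2\<close> are pendant, and the deficiency
  is at least \<open>2n - 6\<close>. Since \<open>p\<close> is congruent to \<open>-4\<close> modulo \<open>n - 1\<close>, the deficiencies always add
  up to at least \<open>2n - 6\<close>.
\<close>

section \<open>Neighbourhoods, degree sums and a criterion for containing
  \<open>T_star n\<close>\<close>

definition nbrs :: "'a graph \<Rightarrow> 'a \<Rightarrow> 'a set" where
  "nbrs G x = {y. {x, y} \<in> edges G}"

lemma nbrs_commute: "y \<in> nbrs G x \<longleftrightarrow> x \<in> nbrs G y"
  by (simp add: nbrs_def insert_commute)

lemma nbrs_irrefl: "simple_graph G \<Longrightarrow> x \<notin> nbrs G x"
  by (auto simp: nbrs_def simple_graph_def)

lemma nbrs_subset: "simple_graph G \<Longrightarrow> nbrs G x \<subseteq> verts G"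
  by (auto simp: nbrs_def simple_graph_def)

lemma finite_nbrs: "simple_graph G \<Longrightarrow> finite (nbrs G x)"
  using nbrs_subset finite_subset by (metis simple_graph_def)

text \<open>Handshake lemma: both sides count incident pairs of a vertex and an edge.\<close>

lemma sum_card_nbrs:
  assumes "simple_graph G"
  shows "(\<Sum>x\<in>verts G. card (nbrs G x)) = 2 * card (edges G)"
proof -
  have fin: "finite (verts G)" and e: "\<And>e. e \<in> edges G \<Longrightarrow> e \<subseteq> verts G \<and> card e = 2"
    using assms by (auto simp: simple_graph_def)
  have finE: "finite (edges G)"
    using e by (intro finite_subset[OF _ finite_Pow_iff[THEN iffD2, OF fin]]) auto
  have "card (nbrs G x) = card {e \<in> edges G. x \<in> e}" for x
  proof (rule bij_betw_same_card[of "\<lambda>y. {x, y}"], unfold bij_betw_def, intro conjI)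
    show "inj_on (\<lambda>y. {x, y}) (nbrs G x)"
      by (auto simp: inj_on_def doubleton_eq_iff)
    show "(\<lambda>y. {x, y}) ` nbrs G x = {e \<in> edges G. x \<in> e}"
    proof (intro equalityI subsetI)
      fix s assume "s \<in> {e \<in> edges G. x \<in> e}"
      then have s: "s \<in> edges G" "x \<in> s" "card s = 2" using e by auto
      then obtain y where "s = {x, y}" by (auto simp: card_2_iff)
      then show "s \<in> (\<lambda>y. {x, y}) ` nbrs G x" using s by (auto simp: nbrs_def)
    qed (auto simp: nbrs_def)
  qed
  then have "(\<Sum>x\<in>verts G. card (nbrs G x)) = (\<Sum>x\<in>verts G. card {e \<in> edges G. x \<in> e})"
    by simp
  also have "\<dots> = 2 * card (edges G)"
  proof (rule sum_multicount[OF fin finE], rule ballI)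
    fix s assume s: "s \<in> edges G"
    then have "{x \<in> verts G. x \<in> s} = s" using e by auto
    then show "card {x \<in> verts G. x \<in> s} = 2" using e s by auto
  qed
  finally show ?thesis .
qed

text \<open>The path \<open>v\<close>, \<open>a\<close>, \<open>b\<close>, \<open>c\<close> is the
  long leg of the tree. The remaining leaves must be neighbours of \<open>v\<close> off this path;
  since \<open>b\<close> and \<open>c\<close> may themselves be adjacent to \<open>v\<close>, they
  are removed before counting, while \<open>a\<close> is one of the \<open>n - 3\<close> neighbours
  counted.\<close>

lemma contains_T_starI:
  assumes G: "simple_graph G" and n: "n \<ge> 4"
    and a: "a \<in> nbrs G v" and b: "b \<in> nbrs G a" and c: "c \<in> nbrs G b"
    and ne: "b \<noteq> v" "c \<noteq> v" "c \<noteq> a"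
    and card: "n - 3 \<le> card (nbrs G v - {b, c})"
  shows "contains_graph G (T_star n)"
proof -
  let ?L = "nbrs G v - {b, c} - {a}"
  have irr: "x \<notin> nbrs G x" for x using nbrs_irrefl[OF G] .
  have ne': "a \<noteq> v" "b \<noteq> a" "c \<noteq> b" using a b c irr by auto
  have fin: "finite (nbrs G v)" using finite_nbrs[OF G] .
  have "card (nbrs G v - {b, c}) = Suc (card ?L)"
    by (rule card.remove) (use fin a ne ne' in auto)
  then have "n - 4 \<le> card ?L" using card by linarith
  then have "card {1..n-4} \<le> card ?L" by simp
  then obtain g where g: "g ` {1..n-4} \<subseteq> ?L" "inj_on g {1..n-4}"
    using fin by (metis card_le_inj finite_Diff finite_atLeastAtMost)
  define f where
    "f i = (if i = 0 then v else if i = n - 3 then a else if i = n - 2 then b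
            else if i = n - 1 then c else g i)" for i
  have f_simps: "f 0 = v" "f (n - 3) = a" "f (n - 2) = b" "f (n - 1) = c" "f (n - Suc 0) = c"
    and f_g: "\<And>i. i \<in> {1..n-4} \<Longrightarrow> f i = g i"
    using n by (auto simp: f_def)
  have verts: "{0..<n} = {1..n-4} \<union> {0, n - 3, n - 2, n - 1}" using n by auto
  have fL: "f ` {1..n-4} \<subseteq> ?L" using g(1) f_g by auto
  have "inj_on f {1..n-4}" using g(2) f_g by (simp add: inj_on_def)
  moreover have "inj_on f {0, n - 3, n - 2, n - 1}"
    unfolding inj_on_def using ne ne' by (auto simp: f_simps)
  moreover have "f ` ({1..n-4} - {0, n - 3, n - 2, n - 1})
      \<inter> f ` ({0, n - 3, n - 2, n - 1} - {1..n-4}) = {}"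
    using fL irr[of v] by (auto simp: f_simps)
  ultimately have inj: "inj_on f {0..<n}" unfolding verts inj_on_Un by blast
  have star: "f i \<in> nbrs G v" if "1 \<le> i" "i \<le> n - 3" for i
  proof (cases "i = n - 3")
    case False
    then have "i \<in> {1..n-4}" using that by auto
    then show ?thesis using fL by blast
  qed (use a f_simps in auto)
  have edges: "f ` e \<in> edges G" if "e \<in> edges (T_star n)" for e
    using that star b c by (auto simp: T_star_def nbrs_def f_simps)
  have "v \<in> nbrs G a" using a nbrs_commute by metis
  then have "v \<in> verts G" using nbrs_subset[OF G] by blast
  then have "f ` {0..<n} \<subseteq> verts G"
    unfolding verts using fL a b c nbrs_subset[OF G] by (auto simp: f_simps)
  moreover have "verts (T_star n) = {0..<n}" by (simp add: T_star_def)
  ultimately show ?thesis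
    unfolding contains_graph_def using inj edges by metis
qed

section \<open>Deficiency of components\<close>

definition closed_in :: "'a graph \<Rightarrow> 'a set \<Rightarrow> bool" where
  "closed_in G A \<longleftrightarrow> A \<subseteq> verts G \<and> (\<forall>x\<in>A. nbrs G x \<subseteq> A)"

text \<open>Connectedness is expressed without walks: a connected component is a minimal nonempty
  set closed under adjacency.\<close>

definition component :: "'a graph \<Rightarrow> 'a set \<Rightarrow> bool" where
  "component G C \<longleftrightarrow> closed_in G C \<and> C \<noteq> {} \<and>
     (\<forall>B. closed_in G B \<and> B \<subseteq> C \<and> B \<noteq> {} \<longrightarrow> B = C)"

lemma component_exists:
  assumes "closed_in G A" "A \<noteq> {}" "finite A"
  obtains C where "component G C" "C \<subseteq> A"
proof -
  let ?P = "\<lambda>B. closed_in G B \<and> B \<subseteq> A \<and> B \<noteq> {}"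
  \<comment> \<open>A set of least cardinality among the nonempty closed subsets is also minimal
    under inclusion.\<close>
  obtain C where C: "?P C" "\<And>B. card B < card C \<Longrightarrow> \<not> ?P B"
    using exists_least_iff[of "\<lambda>k. \<exists>B. ?P B \<and> card B = k"] assms by (metis subset_refl)
  have "B = C" if "closed_in G B" "B \<subseteq> C" "B \<noteq> {}" for B
    using that C assms(3) by (meson card_subset_eq card_mono finite_subset le_neq_implies_less subset_trans)
  then show ?thesis using C(1) by (intro that[of C]) (auto simp: component_def)
qed

text \<open>Integer-valued because vertices of degree above \<open>n - 2\<close> contribute
  negatively.\<close>

definition deficiency :: "nat \<Rightarrow> 'a graph \<Rightarrow> 'a set \<Rightarrow> int" where
  "deficiency n G A = (\<Sum>x\<in>A. int n - 2 - int (card (nbrs G x)))"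

lemma deficiency_eq:
  "deficiency n G A = (int n - 2) * int (card A) - int (\<Sum>x\<in>A. card (nbrs G x))"
  by (simp add: deficiency_def sum_subtractf sum.distrib algebra_simps)

lemma deficiency_lower:
  assumes "\<And>x. x \<in> A \<Longrightarrow> int (card (nbrs G x)) \<le> d"
  shows "int (card A) * (int n - 2 - d) \<le> deficiency n G A"
  unfolding deficiency_def
  by (rule sum_bounded_below) (use assms in fastforce)

lemma deficiency_closed:
  assumes G: "simple_graph G" and C: "closed_in G C"
  shows "int (card C) * (int n - 1 - int (card C)) \<le> deficiency n G C"
proof -
  have fin: "finite C" using G C finite_subset by (auto simp: closed_in_def simple_graph_def)
  have "int (card (nbrs G x)) \<le> int (card C) - 1" if "x \<in> C" for x
  proof -
    have "nbrs G x \<subseteq> C - {x}" using C that nbrs_irrefl[OF G] by (auto simp: closed_in_def)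
    then have "card (nbrs G x) \<le> card (C - {x})" using fin by (intro card_mono) auto
    moreover have "card C = Suc (card (C - {x}))" using fin that by (rule card.remove)
    ultimately show ?thesis by simp
  qed
  from deficiency_lower[OF this, of C n] show ?thesis by (simp add: algebra_simps)
qed

text \<open>Vertices at distance two from \<open>v\<close> are pendant, so the ball of radius two is
  closed and, by minimality, is all of \<open>C\<close>. The degree sum then splits over
  \<open>v\<close>, its neighbourhood and \<open>R\<close>, and there are at most
  \<open>card R\<close> edges between the last two.\<close>

lemma sum_card_nbrs_pendant:
  assumes G: "simple_graph G" and C: "component G C" and v: "v \<in> C"
    and R: "R = C - insert v (nbrs G v)"
    and pend: "\<And>a r. a \<in> nbrs G v \<Longrightarrow> r \<in> nbrs G a \<Longrightarrow> r \<in> R \<Longrightarrow> nbrs G r \<subseteq> {a}"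
  shows "(\<Sum>x\<in>C. card (nbrs G x)) \<le>
     2 * card (nbrs G v) + 2 * card R + (\<Sum>a\<in>nbrs G v. card (nbrs G a \<inter> nbrs G v))"
    and "card C = 1 + card (nbrs G v) + card R"
    and "R \<noteq> {} \<Longrightarrow> \<exists>a\<in>nbrs G v. nbrs G a \<inter> R \<noteq> {}"
proof -
  let ?N = "nbrs G v"
  have cl: "closed_in G C" using C by (simp add: component_def)
  have finC: "finite C" using G cl finite_subset by (auto simp: closed_in_def simple_graph_def)
  have NC: "?N \<subseteq> C" using cl v by (auto simp: closed_in_def)
  have vN: "v \<notin> ?N" using nbrs_irrefl[OF G] .
  have fin: "finite ?N" "finite R" using finC NC finite_subset R by auto
  have C_eq: "C = insert v (?N \<union> R)" using R NC v by auto
  have dis: "?N \<inter> R = {}" "v \<notin> R" using R by auto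
  then show "card C = 1 + card ?N + card R"
    using vN fin by (simp add: C_eq card_Un_disjoint)
  let ?B = "insert v (?N \<union> (\<Union>a\<in>?N. nbrs G a))"
  have sub: "nbrs G a \<subseteq> C" if "a \<in> ?N" for a using that NC cl by (auto simp: closed_in_def)
  have B_sub: "?B \<subseteq> C" using sub v NC by auto
  have "nbrs G x \<subseteq> ?B" if x: "x \<in> ?B" for x
  proof (cases "x \<in> insert v ?N")
    case False
    then obtain a where a: "a \<in> ?N" "x \<in> nbrs G a" using x by auto
    then have "x \<in> R" using False sub by (auto simp: R)
    then show ?thesis using pend[OF a] a by auto
  qed auto
  then have "closed_in G ?B" using B_sub cl by (auto simp: closed_in_def)
  then have B: "?B = C" using C B_sub unfolding component_def by blast
  have reach: "\<exists>a\<in>?N. r \<in> nbrs G a" if "r \<in> R" for r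
    using that B by (auto simp: R)
  then show "R \<noteq> {} \<Longrightarrow> \<exists>a\<in>?N. nbrs G a \<inter> R \<noteq> {}" by blast
  have R1: "card (nbrs G r) \<le> 1" if r: "r \<in> R" for r
  proof -
    obtain a where "a \<in> ?N" "r \<in> nbrs G a" using reach[OF r] by blast
    then have "nbrs G r \<subseteq> {a}" using pend r by blast
    then show ?thesis using card_mono[of "{a}"] by simp
  qed
  \<comment> \<open>Double counting of the edges between the neighbourhood and \<open>R\<close>,
    using that vertices of \<open>R\<close> have degree at most one.\<close>
  have "(\<Sum>a\<in>?N. card (nbrs G a \<inter> R)) = (\<Sum>a\<in>?N. card {r \<in> R. r \<in> nbrs G a})"
    by (intro sum.cong refl arg_cong[where f = card]) auto
  also have "\<dots> = (\<Sum>r\<in>R. card {a \<in> ?N. r \<in> nbrs G a})"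
    by (rule sum_multicount_gen) (use fin in auto)
  also have "\<dots> \<le> (\<Sum>r\<in>R. 1)"
  proof (rule sum_mono)
    fix r assume "r \<in> R"
    have "card {a \<in> ?N. r \<in> nbrs G a} \<le> card (nbrs G r)"
      by (rule card_mono) (auto simp: finite_nbrs[OF G] nbrs_commute)
    then show "card {a \<in> ?N. r \<in> nbrs G a} \<le> 1" using R1[OF \<open>r \<in> R\<close>] by simp
  qed
  finally have NR: "(\<Sum>a\<in>?N. card (nbrs G a \<inter> R)) \<le> card R" by simp
  have "card (nbrs G a) \<le> 1 + card (nbrs G a \<inter> ?N) + card (nbrs G a \<inter> R)" if "a \<in> ?N" for a
  proof -
    have "nbrs G a \<subseteq> {v} \<union> (nbrs G a \<inter> ?N) \<union> (nbrs G a \<inter> R)" using sub[OF that] C_eq by auto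
    then have "card (nbrs G a) \<le> card ({v} \<union> (nbrs G a \<inter> ?N) \<union> (nbrs G a \<inter> R))"
      using fin by (intro card_mono) auto
    also have "\<dots> \<le> card {v} + card (nbrs G a \<inter> ?N) + card (nbrs G a \<inter> R)"
      by (meson add_le_mono1 card_Un_le order_trans)
    finally show ?thesis by simp
  qed
  then have "(\<Sum>a\<in>?N. card (nbrs G a)) \<le>
      (\<Sum>a\<in>?N. 1 + card (nbrs G a \<inter> ?N) + card (nbrs G a \<inter> R))"
    by (rule sum_mono)
  also have "\<dots> \<le> card ?N + (\<Sum>a\<in>?N. card (nbrs G a \<inter> ?N)) + card R"
    using NR by (simp only: sum.distrib) simp
  finally have N: "(\<Sum>a\<in>?N. card (nbrs G a)) \<le> \<dots>" .
  have "(\<Sum>r\<in>R. card (nbrs G r)) \<le> (\<Sum>r\<in>R. 1)" using R1 by (intro sum_mono)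
  moreover have "(\<Sum>x\<in>C. card (nbrs G x)) =
      card ?N + (\<Sum>a\<in>?N. card (nbrs G a)) + (\<Sum>r\<in>R. card (nbrs G r))"
    using vN dis fin by (simp add: C_eq sum.union_disjoint)
  ultimately show "(\<Sum>x\<in>C. card (nbrs G x)) \<le>
     2 * card ?N + 2 * card R + (\<Sum>a\<in>?N. card (nbrs G a \<inter> ?N))"
    using N by simp
qed

text \<open>Since \<open>T_star n\<close> is absent, the component beyond the neighbourhood of
  \<open>v\<close> consists of pendant vertices, and the graph induced on the neighbourhood is
  sparse: it has maximum degree at most 1 if \<open>v\<close> has degree at least
  \<open>n - 1\<close>, and otherwise it has an isolated vertex.\<close>

lemma deficiency_high_degree:
  assumes G: "simple_graph G" and free: "\<not> contains_graph G (T_star n)" and n: "n \<ge> 7"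
    and C: "component G C" and v: "v \<in> C" and deg: "n - 2 \<le> card (nbrs G v)"
    and m: "n \<le> card C"
  shows "2 * int n - 6 \<le> deficiency n G C"
proof -
  let ?N = "nbrs G v"
  define R where "R = C - insert v ?N"
  define d where "d = card ?N"
  define r where "r = card R"
  have fin: "finite ?N" using finite_nbrs[OF G] .
  have irr: "x \<notin> nbrs G x" for x using nbrs_irrefl[OF G] .
  have n4: "n \<ge> 4" using n by simp
  have path: "card (?N - {b, c}) < n - 3"
    if "a \<in> ?N" "b \<in> nbrs G a" "c \<in> nbrs G b" "b \<noteq> v" "c \<noteq> v" "c \<noteq> a" for a b c
    using contains_T_starI[OF G n4 that] free not_le by blast
  \<comment> \<open>If \<open>b\<close> or \<open>c\<close> is not adjacent to \<open>v\<close>,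
    then at most one candidate leaf is lost.\<close>
  have one: "card (?N - {b, c}) \<ge> d - 1" if "b \<notin> ?N \<or> c \<notin> ?N" for b c
  proof -
    have "?N - {b, c} = ?N - {c} \<or> ?N - {b, c} = ?N - {b}" using that by auto
    then show ?thesis unfolding d_def using card_Diff1_le diff_card_le_card_Diff
      by (metis One_nat_def card.empty card.insert empty_iff finite.emptyI finite.insertI)
  qed
  \<comment> \<open>A further neighbour \<open>c\<close> of \<open>x\<close> would give the path
    \<open>v\<close>, \<open>a\<close>, \<open>x\<close>, \<open>c\<close> with \<open>x\<close>
    outside the neighbourhood, leaving at least \<open>d - 1 \<ge> n - 3\<close> neighbours of
    \<open>v\<close>.\<close>
  have pend: "nbrs G x \<subseteq> {a}" if "a \<in> ?N" "x \<in> nbrs G a" "x \<in> R" for a x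
  proof
    fix c assume c: "c \<in> nbrs G x"
    have x: "x \<notin> ?N" "x \<noteq> v" using that(3) by (auto simp: R_def)
    then have "c \<noteq> v" using c nbrs_commute by fast
    then have "c = a \<or> card (?N - {x, c}) < n - 3" using path[OF that(1,2) c x(2)] by blast
    moreover have "d - 1 \<le> card (?N - {x, c})" using one x by blast
    ultimately show "c \<in> {a}" using deg n unfolding d_def by auto
  qed
  note P = sum_card_nbrs_pendant[OF G C v R_def pend]
  have cC: "card C = 1 + d + r" using P(2) by (simp add: d_def r_def)
  have def_ge: "deficiency n G C \<ge> (int n - 2) * (1 + int d + int r) - 2 * int d - 2 * int r
      - int (\<Sum>a\<in>?N. card (nbrs G a \<inter> ?N))"
  proof -
    have "int (\<Sum>x\<in>C. card (nbrs G x)) \<le>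
        2 * int d + 2 * int r + int (\<Sum>a\<in>?N. card (nbrs G a \<inter> ?N))"
      using P(1) unfolding d_def r_def by linarith
    moreover have "deficiency n G C =
        (int n - 2) * (1 + int d + int r) - int (\<Sum>x\<in>C. card (nbrs G x))"
      by (simp add: deficiency_eq cC add.assoc del: of_nat_sum)
    ultimately show ?thesis by linarith
  qed
  have d2: "n - 2 \<le> d" using deg by (simp add: d_def)
  show ?thesis
  proof (cases "n - 1 \<le> d")
    case True
    \<comment> \<open>Two such neighbours \<open>x\<close> and \<open>y\<close> would give the path
      \<open>v\<close>, \<open>x\<close>, \<open>a\<close>, \<open>y\<close>; even after losing both
      \<open>a\<close> and \<open>y\<close>, at least \<open>n - 3\<close> neighbours of
      \<open>v\<close> remain.\<close>
    have "card (nbrs G a \<inter> ?N) \<le> 1" if a: "a \<in> ?N" for a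
    proof (rule ccontr)
      assume "\<not> ?thesis"
      then obtain x y where xy: "x \<in> nbrs G a \<inter> ?N" "y \<in> nbrs G a \<inter> ?N" "x \<noteq> y"
        using fin card_le_Suc0_iff_eq[of "nbrs G a \<inter> ?N"] by auto
      have "a \<in> nbrs G x" "a \<noteq> v" "y \<noteq> v" using xy a irr nbrs_commute by (metis IntD1 IntD2)+
      have "card (?N - {a, y}) < n - 3"
        by (rule path[of x]) (use xy \<open>a \<in> nbrs G x\<close> \<open>a \<noteq> v\<close> \<open>y \<noteq> v\<close> in blast)+
      moreover have "card ?N - card {a, y} \<le> card (?N - {a, y})"
        by (rule diff_card_le_card_Diff) simp
      moreover have "card {a, y} \<le> 2" by (simp add: card_insert_if)
      ultimately show False using True unfolding d_def by linarith
    qed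
    then have "(\<Sum>a\<in>?N. card (nbrs G a \<inter> ?N)) \<le> (\<Sum>a\<in>?N. 1)" by (rule sum_mono)
    then have "int (\<Sum>a\<in>?N. card (nbrs G a \<inter> ?N)) \<le> int d"
      by (simp add: d_def del: of_nat_sum)
    then have "deficiency n G C \<ge>
        (int n - 2) * (1 + int d + int r) - 2 * int d - 2 * int r - int d"
      using def_ge by linarith
    moreover have "(int n - 2) * (1 + int d + int r) - 2 * int d - 2 * int r - int d =
        (int n - 2) + (int n - 5) * int d + (int n - 4) * int r"
      by (simp add: algebra_simps)
    moreover have "2 * int d \<le> (int n - 5) * int d" using n by (intro mult_right_mono) auto
    moreover have "0 \<le> (int n - 4) * int r" using n by simp
    ultimately show ?thesis using True n by linarith
  next
    case False
    then have d: "d = n - 2" using d2 by linarith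
    \<comment> \<open>The closed neighbourhood of \<open>v\<close> has only \<open>n - 1\<close>
      vertices, so a component of order at least \<open>n\<close> must extend beyond it.\<close>
    then have "r \<noteq> 0" using cC m n by linarith
    then have "R \<noteq> {}" by (auto simp: r_def)
    then obtain a y where a: "a \<in> ?N" and y: "y \<in> nbrs G a" "y \<in> R" using P(3) by blast
    have yN: "y \<notin> ?N" "y \<noteq> v" using y by (auto simp: R_def)
    \<comment> \<open>A neighbour \<open>x\<close> of \<open>a\<close> inside \<open>?N\<close>
      would give the path \<open>v\<close>, \<open>x\<close>, \<open>a\<close>, \<open>y\<close>,
      where only \<open>a\<close> is lost as a leaf.\<close>
    have iso: "nbrs G a \<inter> ?N = {}"
    proof (rule ccontr)
      assume "\<not> ?thesis"
      then obtain x where x: "x \<in> nbrs G a" "x \<in> ?N" by blast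
      have "a \<in> nbrs G x" "a \<noteq> v" using x a irr nbrs_commute by metis+
      then have "card (?N - {a, y}) < n - 3"
        by (intro path[of x]) (use x y yN in blast)+
      then show False using one[of a y] yN d by simp
    qed
    \<comment> \<open>Of the \<open>n - 2\<close> vertices of \<open>?N\<close>, both
      \<open>x\<close> itself and the isolated vertex \<open>a\<close> are excluded.\<close>
    have "card (nbrs G x \<inter> ?N) \<le> n - 4" if x: "x \<in> ?N - {a}" for x
    proof -
      have "a \<notin> nbrs G x" using iso x nbrs_commute[of a G x] by blast
      then have "nbrs G x \<inter> ?N \<subseteq> ?N - {a, x}" using irr by blast
      then have "card (nbrs G x \<inter> ?N) \<le> card (?N - {a, x})" using fin by (intro card_mono) auto
      also have "\<dots> = n - 4" using x a d by (auto simp: card_Diff_subset card_insert_if d_def)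
      finally show ?thesis .
    qed
    then have "(\<Sum>x\<in>?N - {a}. card (nbrs G x \<inter> ?N)) \<le> (\<Sum>x\<in>?N - {a}. n - 4)" by (rule sum_mono)
    moreover have "card (?N - {a}) = n - 3" using a d by (simp add: d_def)
    moreover have "(\<Sum>x\<in>?N. card (nbrs G x \<inter> ?N)) = (\<Sum>x\<in>?N - {a}. card (nbrs G x \<inter> ?N))"
      using sum.remove[OF fin a, of "\<lambda>x. card (nbrs G x \<inter> ?N)"] iso by simp
    ultimately have "int (\<Sum>x\<in>?N. card (nbrs G x \<inter> ?N)) \<le> int ((n - 3) * (n - 4))"
      by (simp only: of_nat_le_iff) simp
    then have "int (\<Sum>x\<in>?N. card (nbrs G x \<inter> ?N)) \<le> (int n - 3) * (int n - 4)"
      using n by (simp add: of_nat_diff)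
    then have "deficiency n G C \<ge>
        (int n - 2) * (1 + int d + int r) - 2 * int d - 2 * int r - (int n - 3) * (int n - 4)"
      using def_ge by linarith
    moreover have "(int n - 2) * (1 + int d + int r) - 2 * int d - 2 * int r
        - (int n - 3) * (int n - 4) = 2 * int n - 6 + (int n - 4) * int r"
      using d n by (simp add: of_nat_diff algebra_simps)
    moreover have "0 \<le> (int n - 4) * int r" using n by simp
    ultimately show ?thesis by linarith
  qed
qed

section \<open>Residues of orders modulo \<open>n - 1\<close> and the deficiencies they
  force\<close>

text \<open>The possible pairs of order \<open>p\<close> and deficiency \<open>D\<close> of a union of components. The third case
  arises from one component of order \<open>1\<close> or \<open>n - 2\<close>, the last one from one component of order \<open>m\<close>,
  in both cases together with components of order \<open>n - 1\<close>.\<close>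

definition deficient :: "int \<Rightarrow> int \<Rightarrow> int \<Rightarrow> bool" where
  "deficient n p D \<longleftrightarrow> D \<ge> 2 * n - 6 \<or> (D \<ge> 0 \<and> n - 1 dvd p)
     \<or> (D \<ge> n - 2 \<and> (n - 1 dvd p - 1 \<or> n - 1 dvd p + 1))
     \<or> (\<exists>m\<ge>n. D \<ge> m \<and> n - 1 dvd p - m)"

lemma deficient_component:
  assumes G: "simple_graph G" and free: "\<not> contains_graph G (T_star n)" and n: "n \<ge> 7"
    and C: "component G C"
  shows "deficient (int n) (int (card C)) (deficiency n G C)"
proof -
  define m where "m = int (card C)"
  have cl: "closed_in G C" and "C \<noteq> {}" using C by (auto simp: component_def)
  moreover have "finite C" using G cl finite_subset by (auto simp: closed_in_def simple_graph_def)
  ultimately have m1: "m \<ge> 1" by (simp add: m_def Suc_le_eq card_gt_0_iff)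
  have D: "m * (int n - 1 - m) \<le> deficiency n G C"
    unfolding m_def by (rule deficiency_closed[OF G cl])
  consider "m \<ge> int n" "\<exists>v\<in>C. n - 2 \<le> card (nbrs G v)"
    | "m \<ge> int n" "\<forall>v\<in>C. card (nbrs G v) < n - 2"
    | "m = int n - 1" | "m = int n - 2" | "m = 1" | "2 \<le> m" "m \<le> int n - 3"
    using m1 not_le by fastforce
  then show ?thesis
  proof cases
    case 1
    then show ?thesis using deficiency_high_degree[OF G free n C]
      by (auto simp: deficient_def m_def)
  next
    case 2
    \<comment> \<open>Each vertex now contributes at least 1 to the deficiency.\<close>
    then have "int (card (nbrs G v)) \<le> int n - 3" if "v \<in> C" for v using that n by fastforce
    then have "m * (int n - 2 - (int n - 3)) \<le> deficiency n G C"
      unfolding m_def by (rule deficiency_lower)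
    then have "m \<le> deficiency n G C" by simp
    then show ?thesis using 2(1) unfolding deficient_def m_def
      by (intro disjI2 exI[of _ "int (card C)"]) auto
  next
    case 3
    then show ?thesis using D by (auto simp: deficient_def m_def)
  next
    case 4
    then have "int n - 2 \<le> deficiency n G C" "int n - 1 dvd m + 1" using D by auto
    then show ?thesis by (auto simp: deficient_def m_def)
  next
    case 5
    then have "int n - 2 \<le> deficiency n G C" "int n - 1 dvd m - 1" using D by auto
    then show ?thesis by (auto simp: deficient_def m_def)
  next
    case 6
    \<comment> \<open>This product equals \<open>m * (n - 1 - m) - (2 * n - 6)\<close>: the bound is
      attained at the endpoints \<open>m = 2\<close> and \<open>m = n - 3\<close>.\<close>
    then have "0 \<le> (m - 2) * (int n - 3 - m)" by simp
    then have "2 * int n - 6 \<le> m * (int n - 1 - m)" by (simp add: algebra_simps)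
    then show ?thesis using D by (auto simp: deficient_def)
  qed
qed

text \<open>If neither part falls under the case of order divisible by \<open>n - 1\<close>, each
  has deficiency at least \<open>n - 2\<close>, which together exceeds \<open>2 * n - 6\<close>.
  Otherwise one order vanishes modulo \<open>n - 1\<close> and the other part determines the
  case.\<close>

lemma deficient_add:
  assumes n: "n \<ge> 7" and 1: "deficient n p D" and 2: "deficient n q E"
  shows "deficient n (p + q) (D + E)"
proof -
  have pos: "D \<ge> 0" "E \<ge> 0" using 1 2 n by (auto simp: deficient_def)
  consider "D + E \<ge> 2 * n - 6" | "D \<ge> 0" "n - 1 dvd p" | "E \<ge> 0" "n - 1 dvd q"
    using 1 2 n pos unfolding deficient_def by fastforce
  then show ?thesis
  proof cases
    case 1
    then show ?thesis by (simp add: deficient_def)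
  next
    case p: 2
    have "n - 1 dvd (p + q) - m \<longleftrightarrow> n - 1 dvd q - m" for m
      using dvd_add_right_iff[OF p(2), of "q - m"] by (simp add: algebra_simps)
    \<comment> \<open>The instances 0, 1 and -1 are the fixed residues named in
      \<open>deficient\<close>.\<close>
    from this this[of 0] this[of 1] this[of "-1"] show ?thesis
      using 2 p(1) unfolding deficient_def by fastforce
  next
    case q: 3
    have "n - 1 dvd (p + q) - m \<longleftrightarrow> n - 1 dvd p - m" for m
      using dvd_add_right_iff[OF q(2), of "p - m"] by (simp add: algebra_simps)
    from this this[of 0] this[of 1] this[of "-1"] show ?thesis
      using 1 q(1) unfolding deficient_def by fastforce
  qed
qed

text \<open>Components are split off one at a time; what remains is closed because adjacency is
  symmetric.\<close>

lemma deficient_closed: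
  assumes G: "simple_graph G" and free: "\<not> contains_graph G (T_star n)" and n: "n \<ge> 7"
    and A: "closed_in G A"
  shows "deficient (int n) (int (card A)) (deficiency n G A)"
  using A
proof (induction "card A" arbitrary: A rule: less_induct)
  case less
  show ?case
  proof (cases "A = {}")
    case True
    then show ?thesis by (simp add: deficient_def deficiency_def)
  next
    case False
    have fin: "finite A"
      using G less.prems finite_subset by (auto simp: closed_in_def simple_graph_def)
    obtain C where C: "component G C" "C \<subseteq> A"
      using component_exists[OF less.prems False fin] .
    then have C': "closed_in G C" "C \<noteq> {}" "finite C"
      using fin finite_subset by (auto simp: component_def)
    have split: "card A = card (A - C) + card C"
      using C fin by (metis C'(3) card_Diff_subset card_mono le_add_diff_inverse2)
    have "card C > 0" using C' by (simp add: card_gt_0_iff)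
    then have lt: "card (A - C) < card A" using split by simp
    have "closed_in G (A - C)"
      using less.prems C'(1) nbrs_commute unfolding closed_in_def by fast
    from less.hyps[OF lt this] deficient_component[OF G free n C(1)]
    have "deficient (int n) (int (card (A - C)) + int (card C))
        (deficiency n G (A - C) + deficiency n G C)"
      using n by (intro deficient_add) auto
    moreover have "deficiency n G A = deficiency n G (A - C) + deficiency n G C"
      unfolding deficiency_def by (rule sum.subset_diff[OF C(2) fin])
    ultimately show ?thesis using split by simp
  qed
qed

text \<open>As \<open>p\<close> is -4 modulo \<open>n - 1\<close>, the residues 0, 1 and -1 would
  make \<open>n - 1 \<ge> 6\<close> divide 4, 5 or 3.\<close>

lemma deficient_residue:
  assumes n: "n \<ge> 7" and D: "deficient n p D" and p: "p = k * (n - 1) + n - 5"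
  shows "2 * n - 6 \<le> D"
proof (rule ccontr)
  assume neg: "\<not> ?thesis"
  have p4: "p + 4 = (k + 1) * (n - 1)" using p by (simp add: algebra_simps)
  have small: "\<not> n - 1 dvd j" if "0 < j" "j < n - 1" for j :: int
    using that zdvd_imp_le by fastforce
  have dv: "n - 1 dvd p + 4" using p4 by simp
  from D neg consider "n - 1 dvd p" | "n - 1 dvd p - 1" | "n - 1 dvd p + 1"
    | m where "m \<ge> n" "D \<ge> m" "n - 1 dvd p - m"
    by (auto simp: deficient_def)
  then show False
  proof cases
    case 1
    then show False using dvd_diff[OF dv 1] small[of 4] n by simp
  next
    case 2
    then show False using dvd_diff[OF dv 2] small[of 5] n by simp
  next
    case 3
    then show False using dvd_diff[OF dv 3] small[of 3] n by simp
  next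
    case 4
    \<comment> \<open>Here \<open>m + 4\<close> is a multiple of \<open>n - 1\<close> larger than
      \<open>n - 1\<close>, hence at least \<open>2 * (n - 1)\<close>, so
      \<open>m \<ge> 2 * n - 6\<close>.\<close>
    have "n - 1 dvd (p + 4 - (p - m)) - (n - 1)"
      by (intro dvd_diff dv 4(3) dvd_refl)
    then have "n - 1 \<le> m + 4 - (n - 1)" using zdvd_imp_le 4(1) by fastforce
    then show False using neg 4 by linarith
  qed
qed

text \<open>On the whole vertex set the deficiency is \<open>n - 2\<close> times the order minus
  twice the number of edges, so the lower bound \<open>2 * n - 6\<close> rearranges to the
  claim.\<close>

lemma card_edges_le:
  assumes G: "simple_graph G" and free: "\<not> contains_graph G (T_star n)" and n: "n \<ge> 7"
    and V: "card (verts G) = k * (n - 1) + (n - 5)"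
  shows "2 * int (card (edges G)) \<le> (int n - 2) * (int (card (verts G)) - 2) + 2"
proof -
  have "closed_in G (verts G)" using nbrs_subset[OF G] by (simp add: closed_in_def)
  from deficient_closed[OF G free n this] have "2 * int n - 6 \<le> deficiency n G (verts G)"
    by (rule deficient_residue[where k = "int k", rotated]) (use V n in \<open>auto simp: of_nat_diff\<close>)
  then show ?thesis
    unfolding deficiency_eq sum_card_nbrs[OF G] by (simp add: algebra_simps)
qed

section \<open>The extremal graph\<close>

text \<open>The quotient by \<open>s\<close> names the clique of a vertex below
  \<open>q * s\<close>; the two following intervals of length \<open>t\<close> are the sides of the
  biclique.\<close>

definition cliques_biclique :: "nat \<Rightarrow> nat \<Rightarrow> nat \<Rightarrow> nat graph" where
  "cliques_biclique q s t = ({..<q * s + 2 * t},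
     {{x, y} | x y. x < q * s \<and> y < q * s \<and> x \<noteq> y \<and> x div s = y div s} \<union>
     {{x, y} | x y. x \<in> {q * s..<q * s + t} \<and> y \<in> {q * s + t..<q * s + 2 * t}})"

lemma simple_graph_cliques_biclique: "simple_graph (cliques_biclique q s t)"
  by (auto simp: simple_graph_def cliques_biclique_def)

lemma nbrs_cliques_biclique:
  "y \<in> nbrs (cliques_biclique q s t) x \<longleftrightarrow>
     x < q * s \<and> y < q * s \<and> x \<noteq> y \<and> x div s = y div s \<or>
     x \<in> {q * s..<q * s + t} \<and> y \<in> {q * s + t..<q * s + 2 * t} \<or>
     y \<in> {q * s..<q * s + t} \<and> x \<in> {q * s + t..<q * s + 2 * t}"
  by (auto simp: nbrs_def cliques_biclique_def doubleton_eq_iff)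

lemma div_eq_iff_block:
  fixes x j s :: nat
  assumes "s > 0"
  shows "x div s = j \<longleftrightarrow> x \<in> {j * s..<j * s + s}"
  using assms dividend_less_div_times[of s x] div_times_less_eq_dividend[of x s]
  by (auto intro: div_nat_eqI simp: algebra_simps)

lemma card_edges_cliques_biclique:
  assumes "s > 0"
  shows "2 * card (edges (cliques_biclique q s t)) = q * s * (s - 1) + 2 * t * t"
proof -
  let ?G = "cliques_biclique q s t" and ?M = "q * s"
  have clique: "card (nbrs ?G x) = s - 1" if x: "x < ?M" for x
  proof -
    have "x div s < q" using x assms by (simp add: div_less_iff_less_mult)
    \<comment> \<open>The whole block containing \<open>x\<close> lies below \<open>q * s\<close>,
      so no clique is cut off.\<close>
    then have "Suc (x div s) * s \<le> q * s" by (intro mult_le_mono1) simp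
    then have lt: "y < ?M" if "y \<in> {x div s * s..<x div s * s + s}" for y
      using that by simp
    have "nbrs ?G x = {x div s * s..<x div s * s + s} - {x}"
    proof (rule set_eqI)
      fix y
      have "y \<in> nbrs ?G x \<longleftrightarrow> y < ?M \<and> x \<noteq> y \<and> y div s = x div s"
        using x unfolding nbrs_cliques_biclique by auto
      also have "\<dots> \<longleftrightarrow> y \<in> {x div s * s..<x div s * s + s} - {x}"
        using lt[of y] div_eq_iff_block[OF assms, of y "x div s"] by blast
      finally show "y \<in> nbrs ?G x \<longleftrightarrow> \<dots>" .
    qed
    moreover have "x \<in> {x div s * s..<x div s * s + s}"
      using div_eq_iff_block[OF assms, of x "x div s"] by blast
    ultimately show ?thesis by simp
  qed
  have "nbrs ?G x = {?M + t..<?M + 2 * t}" if "x \<in> {?M..<?M + t}" for x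
    using that by (intro set_eqI) (auto simp: nbrs_cliques_biclique)
  then have left: "card (nbrs ?G x) = t" if "x \<in> {?M..<?M + t}" for x using that by simp
  have "nbrs ?G x = {?M..<?M + t}" if "x \<in> {?M + t..<?M + 2 * t}" for x
    using that by (intro set_eqI) (auto simp: nbrs_cliques_biclique)
  then have right: "card (nbrs ?G x) = t" if "x \<in> {?M + t..<?M + 2 * t}" for x using that by simp
  have V: "verts ?G = {..<?M} \<union> {?M..<?M + 2 * t}" by (auto simp: cliques_biclique_def)
  have "(\<Sum>x\<in>verts ?G. card (nbrs ?G x)) =
      (\<Sum>x<?M. card (nbrs ?G x)) + (\<Sum>x\<in>{?M..<?M + 2 * t}. card (nbrs ?G x))"
    unfolding V by (rule sum.union_disjoint) auto
  also have "(\<Sum>x<?M. card (nbrs ?G x)) = (\<Sum>x<?M. s - 1)"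
    using clique by (intro sum.cong) auto
  also have "(\<Sum>x\<in>{?M..<?M + 2 * t}. card (nbrs ?G x)) = (\<Sum>x\<in>{?M..<?M + 2 * t}. t)"
    using left right by (intro sum.cong refl) (metis atLeastLessThan_iff not_le)
  finally show ?thesis
    using sum_card_nbrs[OF simple_graph_cliques_biclique, of q s t] by simp
qed

text \<open>A clique is one vertex too small. In the biclique, the neighbours of the centre fill the
  opposite side, and the end of the long leg would need another place on that side.\<close>

lemma cliques_biclique_free:
  assumes n: "n \<ge> 4"
  shows "\<not> contains_graph (cliques_biclique q (n - 1) (n - 3)) (T_star n)"
proof
  let ?G = "cliques_biclique q (n - 1) (n - 3)" and ?M = "q * (n - 1)"
  let ?X = "{?M..<?M + (n - 3)}" and ?Y = "{?M + (n - 3)..<?M + 2 * (n - 3)}"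
  assume "contains_graph ?G (T_star n)"
  then obtain f where "inj_on f (verts (T_star n))"
    and e: "\<And>e. e \<in> edges (T_star n) \<Longrightarrow> f ` e \<in> edges ?G"
    unfolding contains_graph_def by blast
  then have inj: "inj_on f {0..<n}" by (simp add: T_star_def)
  have nb: "f j \<in> nbrs ?G (f i)" if "{i, j} \<in> edges (T_star n)" for i j
    using e[OF that] by (simp add: nbrs_def)
  have star: "f i \<in> nbrs ?G (f 0)" if "i \<in> {1..n-3}" for i
    using that by (intro nb) (auto simp: T_star_def)
  have path: "f (n - 2) \<in> nbrs ?G (f (n - 3))" "f (n - 1) \<in> nbrs ?G (f (n - 2))"
    by (intro nb; auto simp: T_star_def)+
  \<comment> \<open>Stated for abstract sides \<open>A\<close> and \<open>B\<close> so that it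
    applies in both orientations.\<close>
  have bip: "f 0 \<notin> A" if cl: "\<And>x. x \<in> A \<Longrightarrow> nbrs ?G x \<subseteq> B" "\<And>x. x \<in> B \<Longrightarrow> nbrs ?G x \<subseteq> A"
    and B: "card B = n - 3" "finite B" for A B
  proof
    assume "f 0 \<in> A"
    then have sub: "f ` {1..n-3} \<subseteq> B" using star cl(1) by blast
    have "inj_on f {1..n-3}" using n by (intro inj_on_subset[OF inj]) auto
    then have "f ` {1..n-3} = B"
      using sub B by (intro card_subset_eq) (auto simp: card_image)
    \<comment> \<open>Two more steps along the leg lead from \<open>B\<close> to \<open>A\<close>
      and back to \<open>B\<close>.\<close>
    moreover have "f (n - 3) \<in> B" using sub n by auto
    then have "f (n - 1) \<in> B" using path cl by blast
    ultimately obtain i where i: "i \<in> {1..n-3}" "f (n - 1) = f i" by auto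
    then have "i < n" "n - 1 \<noteq> i" using n by auto
    then show False using inj_onD[OF inj i(2)] n by simp
  qed
  have "f 0 \<notin> ?X" by (rule bip[of _ ?Y]) (auto simp: nbrs_cliques_biclique)
  moreover have "f 0 \<notin> ?Y" by (rule bip[of _ ?X]) (auto simp: nbrs_cliques_biclique)
  moreover have "f 1 \<in> nbrs ?G (f 0)" using n by (intro star) auto
  ultimately have M: "f 0 < ?M" unfolding nbrs_cliques_biclique by blast
  define j where "j = f 0 div (n - 1)"
  have block: "y < ?M \<and> y div (n - 1) = j"
    if "y \<in> nbrs ?G x" "x < ?M \<and> x div (n - 1) = j" for x y
    using that by (auto simp: nbrs_cliques_biclique)
  have b0: "f 0 < ?M \<and> f 0 div (n - 1) = j" using M by (simp add: j_def)
  have b1: "f i < ?M \<and> f i div (n - 1) = j" if "i \<in> {1..n-3}" for i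
    using block[OF star[OF that] b0] .
  have b2: "f (n - 2) < ?M \<and> f (n - 2) div (n - 1) = j"
    using n by (intro block[OF path(1)] b1) auto
  have b3: "f (n - 1) < ?M \<and> f (n - 1) div (n - 1) = j"
    by (rule block[OF path(2) b2])
  have "f i \<in> {j * (n - 1)..<j * (n - 1) + (n - 1)}" if "i \<in> {0..<n}" for i
  proof -
    have "i = 0 \<or> i \<in> {1..n-3} \<or> i = n - 2 \<or> i = n - 1" using that by auto
    then have "f i div (n - 1) = j" using b0 b1 b2 b3 by blast
    then show ?thesis using div_eq_iff_block[of "n - 1"] n by simp
  qed
  then have "f ` {0..<n} \<subseteq> {j * (n - 1)..<j * (n - 1) + (n - 1)}" by blast
  then have "card (f ` {0..<n}) \<le> n - 1"
    using card_mono[of "{j * (n - 1)..<j * (n - 1) + (n - 1)}"] by fastforce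
  then show False using n by (simp add: card_image[OF inj])
qed

section \<open>The extremal number\<close>

theorem theorem4p3:
  fixes p n k :: nat
  assumes "p \<ge> n" and "n \<ge> 7"
    and "k \<ge> 1"
    and "p = k * (n - 1) + (n - 5)"
  shows "real (turan_ex p (T_star n)) = (real n - 2) * (real p - 2) / 2 + 1"
proof -
  let ?S = "{card (edges G) | G :: nat graph.
    simple_graph G \<and> card (verts G) = p \<and> \<not> contains_graph G (T_star n)}"
  let ?H = "cliques_biclique (k - 1) (n - 1) (n - 3)"
  have n: "n \<ge> 7" and p: "p = k * (n - 1) + (n - 5)" using assms by auto
  \<comment> \<open>These forms of \<open>k\<close> and \<open>n\<close> eliminate truncated
    subtraction, leaving a polynomial identity for the edge count.\<close>
  obtain q where k: "k = Suc q" using assms(3) by (cases k) auto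
  obtain l where l: "n = l + 7" using n by (metis add.commute le_Suc_ex)
  have H: "2 * int (card (edges ?H)) = (int n - 2) * (int p - 2) + 2"
  proof -
    have "2 * card (edges ?H) = q * (n - 1) * (n - 1 - 1) + 2 * (n - 3) * (n - 3)"
      using card_edges_cliques_biclique[of "n - 1"] n k by simp
    then have "2 * int (card (edges ?H)) = int (q * (n - 1) * (n - 1 - 1) + 2 * (n - 3) * (n - 3))"
      by linarith
    then show ?thesis by (simp add: p k l algebra_simps)
  qed
  \<comment> \<open>The order is
    \<open>(k - 1) * (n - 1) + 2 * (n - 3) = k * (n - 1) + (n - 5)\<close>.\<close>
  have "card (verts ?H) = p" using p k n by (simp add: cliques_biclique_def)
  moreover have "\<not> contains_graph ?H (T_star n)" using n by (intro cliques_biclique_free) simp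
  ultimately have mem: "card (edges ?H) \<in> ?S"
    using simple_graph_cliques_biclique[of "k - 1" "n - 1" "n - 3"] by blast
  have "turan_ex p (T_star n) = card (edges ?H)"
    unfolding turan_ex_def
  proof (rule Max_eqI[OF turan_ex_set(1) _ mem])
    fix e assume "e \<in> ?S"
    then obtain G :: "nat graph" where "simple_graph G" "\<not> contains_graph G (T_star n)"
      "card (verts G) = p" and e: "e = card (edges G)" by blast
    then have "2 * int (card (edges G)) \<le> (int n - 2) * (int p - 2) + 2"
      using card_edges_le n p by metis
    then show "e \<le> card (edges ?H)" using H e by linarith
  qed
  moreover have "2 * real (card (edges ?H)) = (real n - 2) * (real p - 2) + 2"
    using arg_cong[OF H, of real_of_int] by simp
  ultimately show ?thesis by simp
qed

end
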